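(* For each $n\ge1$, let $X_n=(X_n(1),\dots,X_n(n))\in\{0,1\}^n$ be a random vector whose law is permutation invariant, and let $\bar X_n:=\bigl(X_n(1)+\dots+X_n(n)\bigr)/n$. Assume that there is $c\in(0,1)$ such that $$\lim_{n\to\infty}P(\bar X_n\ge c)=0$$ and that $X_n\in\mathcal{R}$ for each $n\ge1$. Then $$\lim_{n\to\infty}\operatorname{Var}(\bar X_n)=0.$$
   Context: For a finite set $S$ and a $\sigma$-finite measure $\nu$ on $\mathcal{P}(S)\setminus\{\emptyset\}$ (where $\mathcal{P}(S)$ is the power set), let $Y^\nu=\{B_j\}_{j\in I}$ be the Poisson process on $\mathcal{P}(S)\setminus\{\emptyset\}$ with intensity measure $\nu$. Define $X^\nu=(X^\nu_i)_{i\in S}$ by $X^\nu_i=1$ if $i\in\bigcup_{j\in I}B_j$ and $X^\nu_i=0$ otherwise. $\mathcal{R}$ denotes the set of all $\{0,1\}$-valued processes $(X_i)_{i\in S}$ that are equal in distribution to $X^\nu$ for some $\nu$. Here $S=[n]=\{1,\dots,n\}$ for $X_n$. *)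

theory Defs
  imports "HOL-Probability.Probability" "HOL-Combinatorics.Permutations"
begin

text \<open>
  A \<open>{0,1}\<close>-valued process indexed by \<open>S\<close>; measurability into
  \<^term>\<open>count_space {0, 1 :: real}\<close> includes that all values lie in \<open>{0,1}\<close>.
\<close>

definition binary_process :: "'w measure \<Rightarrow> 'i set \<Rightarrow> ('i \<Rightarrow> 'w \<Rightarrow> real) \<Rightarrow> bool" where
  "binary_process M S X \<longleftrightarrow>
     prob_space M \<and> (\<forall>i\<in>S. X i \<in> M \<rightarrow>\<^sub>M count_space {0, 1})"

definition process_law ::
  "'w measure \<Rightarrow> 'i set \<Rightarrow> ('i \<Rightarrow> 'w \<Rightarrow> real) \<Rightarrow> ('i \<Rightarrow> real) measure" where
  "process_law M S X = distr M (\<Pi>\<^sub>M i\<in>S. count_space {0, 1}) (\<lambda>\<omega>. \<lambda>i\<in>S. X i \<omega>)"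

definition permutation_invariant :: "'w measure \<Rightarrow> 'i set \<Rightarrow> ('i \<Rightarrow> 'w \<Rightarrow> real) \<Rightarrow> bool" where
  "permutation_invariant M S X \<longleftrightarrow>
     (\<forall>\<pi>. \<pi> permutes S \<longrightarrow> process_law M S (\<lambda>i. X (\<pi> i)) = process_law M S X)"

text \<open>
  \<open>Y \<omega>\<close> is the multiset of points of the Poisson process with intensity \<open>\<nu>\<close>; points may
  have multiplicity, since \<open>\<nu>\<close> may have atoms. Finite multisets are the right configurations
  for a finite intensity, which on a finite ground set is the same as a sigma-finite one
  (see \<open>sigma_finite_imp_finite\<close> below). The mass function is written out because
  \<open>poisson_pmf\<close> is only specified for positive rates; here \<open>0 ^ 0 = 1\<close> makes rate \<open>0\<close>
  the point mass at \<open>0\<close>.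
\<close>

definition count_in :: "('w \<Rightarrow> 'b multiset) \<Rightarrow> 'b set \<Rightarrow> 'w \<Rightarrow> nat" where
  "count_in Y A \<omega> = size (filter_mset (\<lambda>B. B \<in> A) (Y \<omega>))"

definition poisson_process :: "'w measure \<Rightarrow> 'b measure \<Rightarrow> ('w \<Rightarrow> 'b multiset) \<Rightarrow> bool" where
  "poisson_process M \<nu> Y \<longleftrightarrow>
     prob_space M \<and> finite_measure \<nu> \<and>
     (\<forall>\<omega>\<in>space M. set_mset (Y \<omega>) \<subseteq> space \<nu>) \<and>
     (\<forall>A\<in>sets \<nu>. count_in Y A \<in> M \<rightarrow>\<^sub>M count_space UNIV \<and>
        (\<forall>k. measure M {\<omega> \<in> space M. count_in Y A \<omega> = k} =
             measure \<nu> A ^ k / fact k * exp (- measure \<nu> A))) \<and>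
     (\<forall>F. finite F \<longrightarrow> F \<subseteq> sets \<nu> \<longrightarrow> disjoint F \<longrightarrow>
        prob_space.indep_vars M (\<lambda>_. count_space UNIV) (\<lambda>A. count_in Y A) F)"

definition covered :: "('w \<Rightarrow> 'i set multiset) \<Rightarrow> 'i \<Rightarrow> 'w \<Rightarrow> real" where
  "covered Y i \<omega> = (if i \<in> \<Union>(set_mset (Y \<omega>)) then 1 else 0)"

text \<open>
  The class \<open>\<R>\<close> for a finite index set \<open>S\<close>. Only the law of \<open>Y\<close> matters, so it is no
  restriction to take its probability space on the type of configurations itself: any
  Poisson process can be replaced by the coordinate process on that type.
\<close>

definition poisson_representable ::
  "'w measure \<Rightarrow> 'i set \<Rightarrow> ('i \<Rightarrow> 'w \<Rightarrow> real) \<Rightarrow> bool" where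
  "poisson_representable M S X \<longleftrightarrow>
     binary_process M S X \<and>
     (\<exists>(\<nu> :: 'i set measure) (M' :: 'i set multiset measure) Y.
        space \<nu> = Pow S - {{}} \<and> sets \<nu> = Pow (Pow S - {{}}) \<and> sigma_finite_measure \<nu> \<and>
        poisson_process M' \<nu> Y \<and>
        process_law M S X = process_law M' S (covered Y))"

lemma sigma_finite_imp_finite:
  assumes "sigma_finite_measure \<nu>" "finite (space \<nu>)"
  shows "finite_measure \<nu>"
proof
  from assms(1) obtain \<A> where \<A>: "\<A> \<subseteq> sets \<nu>" "\<Union>\<A> = space \<nu>"
      "\<forall>A\<in>\<A>. emeasure \<nu> A \<noteq> \<infinity>"
    by (auto simp: sigma_finite_measure_def)
  have "\<A> \<subseteq> Pow (space \<nu>)" using \<A>(2) by blast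
  then have fin: "finite \<A>" using assms(2) by (meson finite_Pow_iff finite_subset)
  have "emeasure \<nu> (space \<nu>) \<le> (\<Sum>A\<in>\<A>. emeasure \<nu> A)"
    using emeasure_subadditive_finite[OF fin, of "\<lambda>A. A" \<nu>] \<A> by auto
  also have "\<dots> < \<infinity>" using fin \<A>(3) by (simp add: less_top)
  finally show "emeasure \<nu> (space \<nu>) \<noteq> \<infinity>" by simp
qed

definition sample_mean :: "nat \<Rightarrow> (nat \<Rightarrow> 'w \<Rightarrow> real) \<Rightarrow> 'w \<Rightarrow> real" where
  "sample_mean n X \<omega> = (\<Sum>i=1..n. X i \<omega>) / real n"

end

theory Submission
  imports Defs
begin

text \<open>
  Let \<open>\<nu>\<close> be the intensity on \<open>S\<close>, \<open>|S| = n\<close>, let \<open>a = \<nu>{B. i \<in> B}\<close>, which by symmetry does not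
  depend on \<open>i\<close>, and let \<open>\<mu>\<close> be the \<open>\<nu>\<close>-mass of the set \<open>D\<close> of those \<open>B\<close> with \<open>|B| \<ge> \<delta> n\<close>. The
  covariance of \<open>X\<^sub>i\<close> and \<open>X\<^sub>j\<close> is at most \<open>\<nu>{B. i, j \<in> B}\<close>, so the variance of the mean is at most
  the integral of \<open>(|B| / n)\<^sup>2\<close>, hence at most \<open>\<delta> a + \<mu>\<close>. As the mean stays below \<open>c\<close> with
  probability close to 1, \<open>a\<close> is bounded. If exactly \<open>r\<close> points of the Poisson process lie in
  \<open>D\<close>, then by symmetry the expected uncovered fraction is at most \<open>(1 - \<delta>)^r\<close>; for large \<open>r\<close> this
  makes the mean exceed \<open>c\<close> with probability at least \<open>P(N(D) = r) / 2\<close>. Therefore \<open>\<mu>\<close> tends to 0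
  for each \<open>\<delta>\<close>.
\<close>

section \<open>Transfer along equality of laws\<close>

lemma binary_process_measurable:
  assumes "binary_process M S X"
  shows "(\<lambda>\<omega>. \<lambda>i\<in>S. X i \<omega>) \<in> M \<rightarrow>\<^sub>M (\<Pi>\<^sub>M i\<in>S. count_space {0, 1})"
  using assms by (intro measurable_restrict) (auto simp: binary_process_def)

lemma process_law_integral_eq:
  fixes g :: "('i \<Rightarrow> real) \<Rightarrow> real"
  assumes "binary_process M S X" "binary_process M' S X'"
    and "process_law M S X = process_law M' S X'"
    and "g \<in> borel_measurable (\<Pi>\<^sub>M i\<in>S. count_space {0, 1})"
  shows "(LINT \<omega>|M. g (\<lambda>i\<in>S. X i \<omega>)) = (LINT \<omega>|M'. g (\<lambda>i\<in>S. X' i \<omega>))"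
proof -
  have "(LINT \<omega>|M. g (\<lambda>i\<in>S. X i \<omega>)) = integral\<^sup>L (process_law M S X) g"
    unfolding process_law_def
    by (rule integral_distr[symmetric, OF binary_process_measurable[OF assms(1)] assms(4)])
  also have "\<dots> = integral\<^sup>L (process_law M' S X') g"
    by (simp only: assms(3))
  also have "\<dots> = (LINT \<omega>|M'. g (\<lambda>i\<in>S. X' i \<omega>))"
    unfolding process_law_def
    by (rule integral_distr[OF binary_process_measurable[OF assms(2)] assms(4)])
  finally show ?thesis .
qed

lemma measure_process_law:
  assumes "binary_process M S X"
    and "{x \<in> space (\<Pi>\<^sub>M i\<in>S. count_space {0, 1}). Q x} \<in> sets (\<Pi>\<^sub>M i\<in>S. count_space {0, 1})"
  shows "measure (process_law M S X) {x \<in> space (\<Pi>\<^sub>M i\<in>S. count_space {0, 1}). Q x} =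
    measure M {\<omega> \<in> space M. Q (\<lambda>i\<in>S. X i \<omega>)}"
  unfolding process_law_def
  using measurable_space[OF binary_process_measurable[OF assms(1)]]
  by (subst measure_distr[OF binary_process_measurable[OF assms(1)] assms(2)])
     (auto intro!: arg_cong[where f = "measure M"])

lemma process_law_prob_eq:
  assumes "binary_process M S X" "binary_process M' S X'"
    and "process_law M S X = process_law M' S X'"
    and "{x \<in> space (\<Pi>\<^sub>M i\<in>S. count_space {0, 1}). Q x} \<in> sets (\<Pi>\<^sub>M i\<in>S. count_space {0, 1})"
  shows "measure M {\<omega> \<in> space M. Q (\<lambda>i\<in>S. X i \<omega>)} =
    measure M' {\<omega> \<in> space M'. Q (\<lambda>i\<in>S. X' i \<omega>)}"
  using measure_process_law[OF assms(1,4)] measure_process_law[OF assms(2,4)] assms(3) by simp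

lemma measurable_coordinate_mean:
  "(\<lambda>x. (\<Sum>i\<in>S. x i) / c) \<in> borel_measurable (\<Pi>\<^sub>M i\<in>S. count_space {0, 1 :: real})"
proof -
  have "(\<lambda>x. x i) \<in> borel_measurable (\<Pi>\<^sub>M i\<in>S. count_space {0, 1 :: real})" if "i \<in> S" for i
    by (rule measurable_compose[OF measurable_component_singleton[OF that]]) simp
  then show ?thesis by measurable
qed

text \<open>Void events are the only events through which the intensity is recovered from the law:
  for a Poisson covering their probability is \<open>exp (- measure \<nu> (hits A))\<close>.\<close>

lemma process_law_prob_zero_eq:
  assumes "binary_process M S X" "binary_process M' S X'"
    and "process_law M S X = process_law M' S X'"
    and "finite S" "A \<subseteq> S"
  shows "measure M {\<omega> \<in> space M. \<forall>i\<in>A. X i \<omega> = 0} =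
    measure M' {\<omega> \<in> space M'. \<forall>i\<in>A. X' i \<omega> = 0}"
proof -
  have fin: "finite A" using assms(4,5) finite_subset by blast
  have "Measurable.pred (\<Pi>\<^sub>M i\<in>S. count_space {0, 1 :: real}) (\<lambda>x. x i = 0)" if "i \<in> A" for i
    using assms(5) that
    by (intro measurable_compose[OF measurable_component_singleton[of i S]]) auto
  then have "{x \<in> space (\<Pi>\<^sub>M i\<in>S. count_space {0, 1 :: real}). \<forall>i\<in>A. x i = 0}
      \<in> sets (\<Pi>\<^sub>M i\<in>S. count_space {0, 1})"
    by (intro predE pred_intros_finite fin) auto
  from process_law_prob_eq[OF assms(1-3) this] show ?thesis
    using assms(5) by (simp add: subset_iff cong: ball_cong)
qed

section \<open>Poisson coverings of a finite set\<close>

locale poisson_cover =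
  fixes S :: "'i set" and \<nu> :: "'i set measure" and M :: "'w measure" and Y
  assumes finite_S: "finite S" and S_ne: "S \<noteq> {}"
    and space_\<nu>: "space \<nu> = Pow S - {{}}" and sets_\<nu>: "sets \<nu> = Pow (Pow S - {{}})"
    and poisson: "poisson_process M \<nu> Y"
begin

sublocale prob_space M
  using poisson by (simp add: poisson_process_def)

sublocale intensity: finite_measure \<nu>
  using poisson by (simp add: poisson_process_def)

definition hits :: "'i set \<Rightarrow> 'i set set" where
  "hits A = {B \<in> space \<nu>. B \<inter> A \<noteq> {}}"

definition large :: "real \<Rightarrow> 'i set set" where
  "large \<delta> = {B \<in> space \<nu>. \<delta> * card S \<le> card B}"

definition containing :: "'i \<Rightarrow> 'i set set" where
  "containing i = {B \<in> space \<nu>. i \<in> B}"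

text \<open>The complement of the mean is more convenient than the mean: products of the factors
  \<open>1 - covered Y i \<omega>\<close> are indicators of void events, so its first two moments
  are averages of exponentials.\<close>

definition uncovered :: "'w \<Rightarrow> real" where
  "uncovered \<omega> = (\<Sum>i\<in>S. 1 - covered Y i \<omega>) / card S"

lemma sets_\<nu>_iff: "A \<in> sets \<nu> \<longleftrightarrow> A \<subseteq> space \<nu>"
  by (simp add: sets_\<nu> space_\<nu>)

lemma finite_space_\<nu>: "finite (space \<nu>)"
  by (simp add: space_\<nu> finite_S)

lemma card_S_pos: "0 < real (card S)"
  using finite_S S_ne by (simp add: card_gt_0_iff)

lemma measure_eq_sum:
  assumes "A \<subseteq> space \<nu>"
  shows "measure \<nu> A = (\<Sum>B\<in>A. measure \<nu> {B})"
  using assms finite_space_\<nu>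
  by (intro intensity.finite_measure_eq_sum_singleton) (auto simp: sets_\<nu>_iff finite_subset)

lemma measurable_count_in:
  assumes "A \<subseteq> space \<nu>"
  shows "count_in Y A \<in> M \<rightarrow>\<^sub>M count_space UNIV"
  using poisson assms by (simp add: poisson_process_def sets_\<nu>_iff)

lemma prob_count_in:
  assumes "A \<subseteq> space \<nu>"
  shows "prob {\<omega> \<in> space M. count_in Y A \<omega> = k} = measure \<nu> A ^ k / fact k * exp (- measure \<nu> A)"
  using poisson assms by (simp add: poisson_process_def sets_\<nu>_iff)

text \<open>Disjoint sets coincide only when both are empty. The assumption
  \<open>A \<noteq> B\<close> excludes this case, in which the family \<open>{A, B}\<close> would
  collapse to one index and the product to one factor.\<close>

lemma prob_count_in_conj:
  assumes "A \<subseteq> space \<nu>" "B \<subseteq> space \<nu>" "A \<inter> B = {}" "A \<noteq> B"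
  shows "prob {\<omega> \<in> space M. count_in Y A \<omega> = k \<and> count_in Y B \<omega> = l} =
    prob {\<omega> \<in> space M. count_in Y A \<omega> = k} * prob {\<omega> \<in> space M. count_in Y B \<omega> = l}"
proof -
  have ind: "indep_vars (\<lambda>_. count_space UNIV) (\<lambda>A. count_in Y A) {A, B}"
  proof -
    have "\<forall>F. finite F \<longrightarrow> F \<subseteq> sets \<nu> \<longrightarrow> disjoint F \<longrightarrow>
        indep_vars (\<lambda>_. count_space UNIV) (\<lambda>A. count_in Y A) F"
      using poisson unfolding poisson_process_def by (elim conjE) assumption
    moreover have "disjoint {A, B}" using assms(3) by (auto simp: disjoint_def)
    moreover have "{A, B} \<subseteq> sets \<nu>" using assms(1,2) by (simp add: sets_\<nu>_iff)
    ultimately show ?thesis by simp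
  qed
  define T where "T C = (if C = A then {k} else {l})" for C
  have "prob (\<Inter>C\<in>{A, B}. count_in Y C -` T C \<inter> space M) =
      (\<Prod>C\<in>{A, B}. prob (count_in Y C -` T C \<inter> space M))"
    by (rule indep_varsD_finite[OF ind]) auto
  moreover have "(\<Inter>C\<in>{A, B}. count_in Y C -` T C \<inter> space M) =
      {\<omega> \<in> space M. count_in Y A \<omega> = k \<and> count_in Y B \<omega> = l}"
    using assms(4) by (auto simp: T_def)
  moreover have "count_in Y A -` T A \<inter> space M = {\<omega> \<in> space M. count_in Y A \<omega> = k}"
    "count_in Y B -` T B \<inter> space M = {\<omega> \<in> space M. count_in Y B \<omega> = l}"
    using assms(4) by (auto simp: T_def)
  ultimately show ?thesis using assms(4) by simp
qed

section \<open>Void events and measurability of the coverage\<close>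

lemma count_in_eq_0_iff: "count_in Y A \<omega> = 0 \<longleftrightarrow> (\<forall>B\<in>#Y \<omega>. B \<notin> A)"
  by (auto simp: count_in_def)

lemma covered_all_0_iff:
  assumes "\<omega> \<in> space M"
  shows "(\<forall>i\<in>A. covered Y i \<omega> = 0) \<longleftrightarrow> count_in Y (hits A) \<omega> = 0"
proof -
  have "set_mset (Y \<omega>) \<subseteq> space \<nu>" using poisson assms by (simp add: poisson_process_def)
  then show ?thesis by (auto simp: count_in_eq_0_iff covered_def hits_def)
qed

lemma hits_subset: "hits A \<subseteq> space \<nu>"
  by (auto simp: hits_def)

lemma hits_singleton: "hits {i} = containing i"
  by (auto simp: hits_def containing_def)

lemma containing_subset: "containing i \<subseteq> space \<nu>"
  by (auto simp: containing_def)

lemma large_subset: "large \<delta> \<subseteq> space \<nu>"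
  by (auto simp: large_def)

lemma prob_covered_all_0:
  "prob {\<omega> \<in> space M. \<forall>i\<in>A. covered Y i \<omega> = 0} = exp (- measure \<nu> (hits A))"
proof -
  have "{\<omega> \<in> space M. \<forall>i\<in>A. covered Y i \<omega> = 0} = {\<omega> \<in> space M. count_in Y (hits A) \<omega> = 0}"
    using covered_all_0_iff by blast
  then show ?thesis using prob_count_in[OF hits_subset, of A 0] by simp
qed

text \<open>Measurability is given for counts only; this form lets \<open>covered\<close> inherit
  it.\<close>

lemma covered_eq:
  assumes "\<omega> \<in> space M"
  shows "covered Y i \<omega> = (if count_in Y (containing i) \<omega> = 0 then 0 else 1)"
proof -
  have "covered Y i \<omega> = 0 \<longleftrightarrow> count_in Y (containing i) \<omega> = 0"
    using covered_all_0_iff[OF assms, of "{i}"] by (simp add: hits_singleton)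
  moreover have "covered Y i \<omega> = 0 \<or> covered Y i \<omega> = 1" by (simp add: covered_def)
  ultimately show ?thesis by auto
qed

lemma one_minus_covered:
  assumes "\<omega> \<in> space M"
  shows "1 - covered Y i \<omega> = indicator {\<omega> \<in> space M. count_in Y (containing i) \<omega> = 0} \<omega>"
  using assms by (simp add: covered_eq)

lemma abs_one_minus_covered: "\<bar>1 - covered Y i \<omega>\<bar> \<le> 1"
  by (simp add: covered_def)

lemma binary_process_covered: "binary_process M A (covered Y)"
proof -
  have "covered Y i \<in> M \<rightarrow>\<^sub>M count_space {0, 1}" for i
  proof -
    have "(\<lambda>\<omega>. if count_in Y (containing i) \<omega> = 0 then 0 else 1) \<in> M \<rightarrow>\<^sub>M count_space {0, 1 :: real}"
      using measurable_count_in[OF containing_subset]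
      by (rule measurable_compose) simp
    then show ?thesis
      by (simp add: covered_eq cong: measurable_cong)
  qed
  then show ?thesis by (simp add: binary_process_def prob_space_axioms)
qed

lemma event_uncovered: "{\<omega> \<in> space M. count_in Y (containing i) \<omega> = 0} \<in> events"
  using measurable_count_in[OF containing_subset] by measurable

lemma measurable_covered [measurable]: "covered Y i \<in> borel_measurable M"
proof -
  have "covered Y i \<in> M \<rightarrow>\<^sub>M count_space {0, 1}"
    using binary_process_covered[of "{i}"] by (simp add: binary_process_def)
  then show ?thesis
    by (rule measurable_compose) simp
qed

lemma measurable_uncovered [measurable]: "uncovered \<in> borel_measurable M"
  unfolding uncovered_def by measurable

lemma uncovered_bounds: "0 \<le> uncovered \<omega>" "uncovered \<omega> \<le> 1"
proof -
  have "(\<Sum>i\<in>S. 1 - covered Y i \<omega>) \<le> (\<Sum>i\<in>S. 1)"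
    by (intro sum_mono) (auto simp: covered_def)
  then show "uncovered \<omega> \<le> 1" using card_S_pos by (simp add: uncovered_def)
  show "0 \<le> uncovered \<omega>"
    by (auto simp: uncovered_def covered_def intro!: sum_nonneg divide_nonneg_nonneg)
qed

lemma integrable_uncovered: "integrable M uncovered"
  using uncovered_bounds by (intro integrable_const_bound[where B = 1]) auto

lemma uncovered_eq: "uncovered \<omega> = 1 - (\<Sum>i\<in>S. covered Y i \<omega>) / card S"
  using card_S_pos by (simp add: uncovered_def sum_subtractf field_simps)

text \<open>Both sides sum the mass of \<open>B\<close> over all pairs of a site \<open>i\<close>
  and a set \<open>B\<close> in \<open>A\<close> with \<open>i \<in> B\<close>.\<close>

lemma double_count:
  assumes "A \<subseteq> space \<nu>"
  shows "(\<Sum>i\<in>S. measure \<nu> (A \<inter> containing i)) = (\<Sum>B\<in>A. measure \<nu> {B} * card B)"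
proof -
  have finA: "finite A" using assms finite_space_\<nu> finite_subset by blast
  have "(\<Sum>i\<in>S. measure \<nu> (A \<inter> containing i)) =
      (\<Sum>i\<in>S. \<Sum>B\<in>A. if i \<in> B then measure \<nu> {B} else 0)"
  proof (rule sum.cong[OF refl])
    fix i
    have "A \<inter> containing i = {B \<in> A. i \<in> B}" using assms by (auto simp: containing_def)
    then show "measure \<nu> (A \<inter> containing i) = (\<Sum>B\<in>A. if i \<in> B then measure \<nu> {B} else 0)"
      using assms finA by (subst measure_eq_sum) (auto simp: sum.inter_filter)
  qed
  also have "\<dots> = (\<Sum>B\<in>A. \<Sum>i\<in>S. if i \<in> B then measure \<nu> {B} else 0)"
    by (rule sum.swap)
  also have "\<dots> = (\<Sum>B\<in>A. measure \<nu> {B} * card B)"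
  proof (rule sum.cong[OF refl])
    fix B assume "B \<in> A"
    then have "S \<inter> B = B" using assms by (auto simp: space_\<nu>)
    then show "(\<Sum>i\<in>S. if i \<in> B then measure \<nu> {B} else 0) = measure \<nu> {B} * card B"
      using finite_S by (simp add: sum.If_cases)
  qed
  finally show ?thesis .
qed

section \<open>The variance bound\<close>

lemma expectation_uncovered: "expectation uncovered = (\<Sum>i\<in>S. exp (- measure \<nu> (containing i))) / card S"
proof -
  have "expectation (\<lambda>\<omega>. 1 - covered Y i \<omega>) = exp (- measure \<nu> (containing i))" for i
  proof -
    have "expectation (\<lambda>\<omega>. 1 - covered Y i \<omega>) =
        expectation (indicator {\<omega> \<in> space M. count_in Y (containing i) \<omega> = 0})"
      by (intro Bochner_Integration.integral_cong one_minus_covered refl)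
    also have "\<dots> = prob {\<omega> \<in> space M. count_in Y (containing i) \<omega> = 0}"
      using event_uncovered by simp
    finally show ?thesis
      using prob_count_in[OF containing_subset, of i 0] by simp
  qed
  moreover have "integrable M (\<lambda>\<omega>. 1 - covered Y i \<omega>)" for i
    by (rule integrable_const_bound[where B = 1]) (simp_all add: abs_one_minus_covered)
  ultimately show ?thesis
    unfolding uncovered_def by (simp del: Bochner_Integration.integral_diff)
qed

text \<open>Expanding the square leaves the probabilities that two sites are both uncovered. The
  diagonal needs no separate treatment, because \<open>{i, i}\<close> is just
  \<open>{i}\<close>.\<close>

lemma expectation_uncovered_sq:
  "expectation (\<lambda>\<omega>. (uncovered \<omega>)\<^sup>2) = (\<Sum>i\<in>S. \<Sum>j\<in>S. exp (- measure \<nu> (hits {i, j}))) / (card S)\<^sup>2"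
proof -
  let ?U = "\<lambda>i j \<omega>. (1 - covered Y i \<omega>) * (1 - covered Y j \<omega>)"
  have E: "expectation (?U i j) = exp (- measure \<nu> (hits {i, j}))" for i j
  proof -
    have "expectation (?U i j) = expectation (indicator {\<omega> \<in> space M. \<forall>k\<in>{i, j}. covered Y k \<omega> = 0})"
      by (intro Bochner_Integration.integral_cong refl) (auto simp: covered_def indicator_def)
    also have "\<dots> = prob {\<omega> \<in> space M. \<forall>k\<in>{i, j}. covered Y k \<omega> = 0}"
      by (subst Bochner_Integration.integral_indicator) (auto intro!: arg_cong[where f = prob])
    finally show ?thesis by (simp only: prob_covered_all_0)
  qed
  have I: "integrable M (?U i j)" for i j
    by (rule integrable_const_bound[where B = 1])
       (simp_all add: abs_mult abs_one_minus_covered mult_le_one)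
  have "expectation (\<lambda>\<omega>. (uncovered \<omega>)\<^sup>2) =
      expectation (\<lambda>\<omega>. (\<Sum>i\<in>S. \<Sum>j\<in>S. ?U i j \<omega>) / (card S)\<^sup>2)"
    by (simp add: uncovered_def power2_eq_square sum_product)
  also have "\<dots> = (\<Sum>i\<in>S. \<Sum>j\<in>S. expectation (?U i j)) / (card S)\<^sup>2"
    using I by (subst integral_divide_zero, subst Bochner_Integration.integral_sum)
      (auto intro!: Bochner_Integration.integrable_sum sum.cong
        arg_cong2[where f = divide] Bochner_Integration.integral_sum
        simp del: Bochner_Integration.integral_diff)
  finally show ?thesis by (simp only: E)
qed

text \<open>With \<open>a\<close>, \<open>b\<close> the masses of \<open>containing i\<close>,
  \<open>containing j\<close> and \<open>m\<close> that of their intersection, the left side is the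
  covariance of the indicators that \<open>i\<close> and \<open>j\<close> are uncovered. It factors
  as a number at most 1 times \<open>1 - exp (- m)\<close>.\<close>

lemma exp_covariance_le:
  fixes a b m :: real
  assumes "0 \<le> m" "m \<le> a" "0 \<le> b"
  shows "exp (- (a + b - m)) - exp (- a) * exp (- b) \<le> m"
proof -
  have "exp (- (a + b - m)) - exp (- a) * exp (- b) = exp (- (a + b - m)) * (1 - exp (- m))"
    by (simp add: algebra_simps flip: exp_add)
  also have "\<dots> \<le> 1 * (1 - exp (- m))"
    using assms by (intro mult_right_mono) auto
  also have "\<dots> \<le> m" using exp_ge_add_one_self[of "- m"] by simp
  finally show ?thesis .
qed

lemma measure_hits_pair:
  "measure \<nu> (hits {i, j}) =
    measure \<nu> (containing i) + measure \<nu> (containing j) - measure \<nu> (containing i \<inter> containing j)"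
proof -
  have "hits {i, j} = containing i \<union> containing j" by (auto simp: hits_def containing_def)
  then show ?thesis
    using containing_subset
    by (simp add: measure_Un3 intensity.fmeasurable_eq_sets sets_\<nu>_iff)
qed

lemma variance_uncovered_le_pairs:
  "variance uncovered \<le> (\<Sum>i\<in>S. \<Sum>j\<in>S. measure \<nu> (containing i \<inter> containing j)) / (card S)\<^sup>2"
proof -
  let ?a = "\<lambda>i. measure \<nu> (containing i)"
  have "integrable M (\<lambda>\<omega>. (uncovered \<omega>)\<^sup>2)"
    using uncovered_bounds
    by (intro integrable_const_bound[where B = 1]) (auto simp: power_le_one)
  with integrable_uncovered have "variance uncovered = expectation (\<lambda>\<omega>. (uncovered \<omega>)\<^sup>2) - (expectation uncovered)\<^sup>2"
    by (rule variance_eq)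
  also have "\<dots> = (\<Sum>i\<in>S. \<Sum>j\<in>S. exp (- measure \<nu> (hits {i, j})) - exp (- ?a i) * exp (- ?a j)) / (card S)\<^sup>2"
    unfolding expectation_uncovered expectation_uncovered_sq
    by (simp add: sum_subtractf power2_eq_square sum_product diff_divide_distrib)
  also have "\<dots> \<le> (\<Sum>i\<in>S. \<Sum>j\<in>S. measure \<nu> (containing i \<inter> containing j)) / (card S)\<^sup>2"
  proof (intro divide_right_mono sum_mono)
    fix i j
    show "exp (- measure \<nu> (hits {i, j})) - exp (- ?a i) * exp (- ?a j)
        \<le> measure \<nu> (containing i \<inter> containing j)"
      unfolding measure_hits_pair
      by (rule exp_covariance_le)
         (auto intro!: intensity.finite_measure_mono simp: sets_\<nu>_iff containing_subset)
  qed simp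
  finally show ?thesis .
qed

text \<open>Double counting is used twice, first over \<open>j\<close> inside
  \<open>containing i\<close> and then over \<open>i\<close>, so each \<open>B\<close> contributes
  its mass once for every ordered pair of its elements.\<close>

lemma variance_uncovered_le_sum:
  "variance uncovered \<le> (\<Sum>B\<in>space \<nu>. measure \<nu> {B} * (card B / card S)\<^sup>2)"
proof -
  have "(\<Sum>i\<in>S. \<Sum>j\<in>S. measure \<nu> (containing i \<inter> containing j)) =
      (\<Sum>i\<in>S. \<Sum>B\<in>containing i. measure \<nu> {B} * card B)"
    by (intro sum.cong refl double_count containing_subset)
  also have "\<dots> = (\<Sum>i\<in>S. \<Sum>B\<in>space \<nu>. if i \<in> B then measure \<nu> {B} * card B else 0)"
    unfolding containing_def using finite_space_\<nu>
    by (intro sum.cong[OF refl] sum.inter_filter)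
  also have "\<dots> = (\<Sum>B\<in>space \<nu>. \<Sum>i\<in>S. if i \<in> B then measure \<nu> {B} * card B else 0)"
    by (rule sum.swap)
  also have "\<dots> = (\<Sum>B\<in>space \<nu>. measure \<nu> {B} * (card B)\<^sup>2)"
  proof (rule sum.cong[OF refl])
    fix B assume "B \<in> space \<nu>"
    then have "S \<inter> B = B" by (auto simp: space_\<nu>)
    then show "(\<Sum>i\<in>S. if i \<in> B then measure \<nu> {B} * card B else 0) = measure \<nu> {B} * (card B)\<^sup>2"
      using finite_S by (simp add: sum.If_cases power2_eq_square)
  qed
  finally show ?thesis
    using variance_uncovered_le_pairs
    by (simp add: sum_divide_distrib power_divide)
qed

lemma variance_uncovered_le:
  assumes "0 \<le> \<delta>"
  shows "variance uncovered \<le>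
    \<delta> * ((\<Sum>i\<in>S. measure \<nu> (containing i)) / card S) + measure \<nu> (large \<delta>)"
proof -
  have "measure \<nu> {B} * (card B / card S)\<^sup>2 \<le>
      \<delta> * (measure \<nu> {B} * card B / card S) + (if B \<in> large \<delta> then measure \<nu> {B} else 0)"
    if B: "B \<in> space \<nu>" for B
  proof -
    define x where "x = card B / card S"
    have "card B \<le> card S" using B finite_S by (auto simp: space_\<nu> card_mono)
    then have x: "0 \<le> x" "x \<le> 1" using card_S_pos by (auto simp: x_def)
    \<comment> \<open>For a set that is not large, one factor of the square is at most \<delta>; for
      a large one the whole square is at most 1.\<close>
    have "x\<^sup>2 \<le> \<delta> * x + (if B \<in> large \<delta> then 1 else 0)"
    proof (cases "B \<in> large \<delta>")
      case True
      have "x\<^sup>2 \<le> 1" "0 \<le> \<delta> * x" using x assms by (auto simp: power_le_one)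
      with True show ?thesis by simp
    next
      case False
      then have "x \<le> \<delta>" using B card_S_pos by (auto simp: large_def x_def field_simps)
      then show ?thesis using False x by (simp add: power2_eq_square mult_right_mono)
    qed
    then have "measure \<nu> {B} * x\<^sup>2 \<le> measure \<nu> {B} * (\<delta> * x + (if B \<in> large \<delta> then 1 else 0))"
      by (rule mult_left_mono) simp
    then show ?thesis by (simp add: x_def algebra_simps split: if_splits)
  qed
  then have "(\<Sum>B\<in>space \<nu>. measure \<nu> {B} * (card B / card S)\<^sup>2) \<le>
      (\<Sum>B\<in>space \<nu>. \<delta> * (measure \<nu> {B} * card B / card S) + (if B \<in> large \<delta> then measure \<nu> {B} else 0))"
    by (rule sum_mono)
  also have "\<dots> = \<delta> * ((\<Sum>B\<in>space \<nu>. measure \<nu> {B} * card B) / card S) + measure \<nu> (large \<delta>)"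
    using large_subset[of \<delta>] finite_space_\<nu> measure_eq_sum[OF large_subset, of \<delta>]
    by (simp add: sum.distrib sum_distrib_left sum_divide_distrib sum.If_cases Int_absorb1)
  also have "(\<Sum>B\<in>space \<nu>. measure \<nu> {B} * card B) = (\<Sum>i\<in>S. measure \<nu> (containing i))"
    using double_count[of "space \<nu>"] containing_subset by (simp add: Int_absorb1)
  finally show ?thesis using variance_uncovered_le_sum by linarith
qed

end

section \<open>Exchangeable Poisson coverings\<close>

text \<open>Symmetry is required of void events only. This already determines that the intensity
  itself is invariant, as shown next.\<close>

locale exchangeable_poisson_cover = poisson_cover +
  assumes exchangeable: "\<And>\<pi> A. \<pi> permutes S \<Longrightarrow> A \<subseteq> S \<Longrightarrow>
    measure M {\<omega> \<in> space M. \<forall>i\<in>\<pi> ` A. covered Y i \<omega> = 0} =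
    measure M {\<omega> \<in> space M. \<forall>i\<in>A. covered Y i \<omega> = 0}"
begin

section \<open>Permutation invariance of the intensity\<close>

lemma measure_subsets_permute:
  assumes "\<pi> permutes S" "A \<subseteq> S"
  shows "measure \<nu> (Pow (\<pi> ` A) - {{}}) = measure \<nu> (Pow A - {{}})"
proof -
  have "measure \<nu> (hits (\<pi> ` (S - A))) = measure \<nu> (hits (S - A))"
    using exchangeable[OF assms(1), of "S - A"] unfolding prob_covered_all_0 by simp
  moreover have "\<pi> ` (S - A) = S - \<pi> ` A"
    using permutes_inj[OF assms(1)] permutes_image[OF assms(1)] by (simp add: image_set_diff)
  \<comment> \<open>A set lies inside \<open>C\<close> exactly when it misses \<open>S - C\<close>,
    so void probabilities determine the mass of the nonempty subsets of \<open>C\<close>.\<close>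
  moreover have "measure \<nu> (Pow C - {{}}) = measure \<nu> (space \<nu>) - measure \<nu> (hits (S - C))"
    if "C \<subseteq> S" for C
  proof -
    have "Pow C - {{}} = space \<nu> - hits (S - C)"
      using that by (auto simp: hits_def space_\<nu>)
    then show ?thesis using hits_subset by (simp add: intensity.finite_measure_compl sets_\<nu>_iff)
  qed
  moreover have "\<pi> ` A \<subseteq> S" using permutes_image[OF assms(1)] assms(2) by blast
  ultimately show ?thesis using assms(2) by simp
qed

text \<open>Moebius inversion on the subset lattice, carried out as an induction on
  \<open>card A\<close>: the masses of all nonempty subsets agree in total, and those of the proper
  ones agree by induction.\<close>

lemma measure_singleton_permute:
  assumes "\<pi> permutes S" "A \<subseteq> S" "A \<noteq> {}"
  shows "measure \<nu> {\<pi> ` A} = measure \<nu> {A}"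
  using assms(2,3)
proof (induction "card A" arbitrary: A rule: less_induct)
  case less
  have inj: "inj \<pi>" by (rule permutes_inj[OF assms(1)])
  have finA: "finite A" using less.prems finite_S finite_subset by blast
  have piA: "\<pi> ` A \<subseteq> S" using permutes_image[OF assms(1)] less.prems by blast
  have split: "measure \<nu> (Pow C - {{}}) = measure \<nu> {C} + (\<Sum>B\<in>Pow C - {{}, C}. measure \<nu> {B})"
    if "C \<subseteq> S" "C \<noteq> {}" for C
  proof -
    have fin: "finite (Pow C - {{}})" using that finite_S finite_subset by blast
    have "(Pow C - {{}}) - {C} = Pow C - {{}, C}" by blast
    then show ?thesis
      using that by (subst measure_eq_sum) (auto simp: space_\<nu> sum.remove[OF fin, of C])
  qed
  have "(\<Sum>B\<in>Pow (\<pi> ` A) - {{}, \<pi> ` A}. measure \<nu> {B}) = (\<Sum>B\<in>Pow A - {{}, A}. measure \<nu> {\<pi> ` B})"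
  proof (rule sum.reindex_cong[where l = "image \<pi>"])
    show "inj_on ((`) \<pi>) (Pow A - {{}, A})"
      by (intro inj_onI) (simp add: inj_image_eq_iff[OF inj])
    show "Pow (\<pi> ` A) - {{}, \<pi> ` A} = (`) \<pi> ` (Pow A - {{}, A})"
      by (subst image_set_diff)
         (auto simp: image_Pow_surj[OF refl] inj_image_eq_iff[OF inj] intro!: injI)
  qed simp
  also have "\<dots> = (\<Sum>B\<in>Pow A - {{}, A}. measure \<nu> {B})"
  proof (rule sum.cong[OF refl])
    fix B assume B: "B \<in> Pow A - {{}, A}"
    then have "card B < card A" by (intro psubset_card_mono finA) auto
    then show "measure \<nu> {\<pi> ` B} = measure \<nu> {B}"
      using less.hyps[of B] B less.prems by auto
  qed
  finally show ?case
    using split[of A] split[of "\<pi> ` A"] measure_subsets_permute[OF assms(1) less.prems(1)]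
      less.prems piA by simp
qed

lemma measure_large_containing_eq:
  assumes "i \<in> S" "j \<in> S"
  shows "measure \<nu> (large \<delta> \<inter> containing i) = measure \<nu> (large \<delta> \<inter> containing j)"
proof -
  define \<pi> where "\<pi> = Transposition.transpose i j"
  have p: "\<pi> permutes S" using assms by (simp add: \<pi>_def permutes_swap_id)
  have inj: "inj \<pi>" by (rule permutes_inj[OF p])
  have inv: "\<pi> ` \<pi> ` B = B" for B by (simp add: \<pi>_def image_image)
  \<comment> \<open>As the transposition is an involution and preserves cardinalities, this one
    fact, with \<open>k\<close> either \<open>i\<close> or \<open>j\<close>, yields both inclusions
    of \<open>img\<close>.\<close>
  have map: "\<pi> ` B \<in> large \<delta> \<inter> containing (\<pi> k)" if "B \<in> large \<delta> \<inter> containing k" for B k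
    using that permutes_image[OF p] card_image[OF inj_on_subset[OF inj subset_UNIV], of B]
    by (auto simp: large_def containing_def space_\<nu>)
  have img: "large \<delta> \<inter> containing j = (`) \<pi> ` (large \<delta> \<inter> containing i)"
  proof (intro equalityI subsetI)
    fix B assume "B \<in> large \<delta> \<inter> containing j"
    from map[OF this] have "\<pi> ` B \<in> large \<delta> \<inter> containing i" by (simp add: \<pi>_def)
    then show "B \<in> (`) \<pi> ` (large \<delta> \<inter> containing i)" by (metis inv image_eqI)
  next
    fix B assume "B \<in> (`) \<pi> ` (large \<delta> \<inter> containing i)"
    then obtain C where "C \<in> large \<delta> \<inter> containing i" "B = \<pi> ` C" by blast
    with map[of C i] show "B \<in> large \<delta> \<inter> containing j" by (simp add: \<pi>_def)
  qed
  have "measure \<nu> (large \<delta> \<inter> containing j) = (\<Sum>B\<in>large \<delta> \<inter> containing j. measure \<nu> {B})"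
    using large_subset by (intro measure_eq_sum) blast
  also have "\<dots> = (\<Sum>B\<in>large \<delta> \<inter> containing i. measure \<nu> {\<pi> ` B})"
    unfolding img by (rule sum.reindex_cong[OF _ refl refl])
      (auto intro!: inj_onI simp: inj_image_eq_iff[OF inj])
  also have "\<dots> = (\<Sum>B\<in>large \<delta> \<inter> containing i. measure \<nu> {B})"
    by (intro sum.cong refl measure_singleton_permute[OF p]) (auto simp: large_def space_\<nu>)
  also have "\<dots> = measure \<nu> (large \<delta> \<inter> containing i)"
    using large_subset by (intro measure_eq_sum[symmetric]) blast
  finally show ?thesis ..
qed

section \<open>Large sets force a large covered fraction\<close>

lemma measure_large_containing_ge:
  assumes "i \<in> S"
  shows "\<delta> * measure \<nu> (large \<delta>) \<le> measure \<nu> (large \<delta> \<inter> containing i)"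
proof -
  have "card S * (\<delta> * measure \<nu> (large \<delta>)) = (\<Sum>B\<in>large \<delta>. measure \<nu> {B} * (\<delta> * card S))"
    by (simp add: measure_eq_sum[OF large_subset] sum_distrib_left sum_distrib_right mult_ac)
  also have "\<dots> \<le> (\<Sum>B\<in>large \<delta>. measure \<nu> {B} * card B)"
    by (intro sum_mono mult_left_mono) (auto simp: large_def)
  also have "\<dots> = (\<Sum>j\<in>S. measure \<nu> (large \<delta> \<inter> containing j))"
    by (rule double_count[symmetric, OF large_subset])
  \<comment> \<open>Symmetry turns the average over all sites into the value at the single site
    \<open>i\<close>.\<close>
  also have "\<dots> = (\<Sum>j\<in>S. measure \<nu> (large \<delta> \<inter> containing i))"
    by (intro sum.cong refl measure_large_containing_eq assms)
  also have "\<dots> = card S * measure \<nu> (large \<delta> \<inter> containing i)" by simp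
  finally show ?thesis using card_S_pos by simp
qed

text \<open>Each of the \<open>r\<close> large points avoids \<open>i\<close> with conditional
  probability at most \<open>1 - \<delta>\<close>. The bound is stated for joint probabilities, and
  conditioning is replaced by splitting \<open>large \<delta>\<close> into the independent parts
  that contain \<open>i\<close> and that avoid it.\<close>

lemma prob_uncovered_large_count_le:
  assumes "i \<in> S" "0 < measure \<nu> (large \<delta>)" "\<delta> \<le> 1"
  shows "prob {\<omega> \<in> space M. count_in Y (containing i) \<omega> = 0 \<and> count_in Y (large \<delta>) \<omega> = r}
    \<le> (1 - \<delta>) ^ r * prob {\<omega> \<in> space M. count_in Y (large \<delta>) \<omega> = r}"
proof -
  let ?D = "large \<delta>" and ?A = "large \<delta> \<inter> containing i" and ?B = "large \<delta> - containing i"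
  have sub: "?A \<subseteq> space \<nu>" "?B \<subseteq> space \<nu>" using large_subset by blast+
  \<comment> \<open>Positive mass ensures that the two disjoint parts are not both empty, hence
    distinct, as \<open>prob_count_in_conj\<close> demands.\<close>
  have "?D \<noteq> {}" using assms(2) by auto
  then have ne: "?A \<noteq> ?B" by blast
  have mB: "measure \<nu> ?B = measure \<nu> ?D - measure \<nu> ?A"
    using intensity.finite_measure_Diff'[of ?D "containing i"] large_subset containing_subset
    by (simp add: sets_\<nu>_iff)
  have le: "measure \<nu> ?B \<le> (1 - \<delta>) * measure \<nu> ?D"
    using measure_large_containing_ge[OF assms(1), of \<delta>] mB by (simp add: algebra_simps)
  have m1: "count_in Y ?B \<omega> = r"
    if "count_in Y (containing i) \<omega> = 0" "count_in Y ?D \<omega> = r" for \<omega>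
  proof -
    have "filter_mset (\<lambda>B. B \<in> ?D) (Y \<omega>) = filter_mset (\<lambda>B. B \<in> ?B) (Y \<omega>)"
      using that(1) by (intro filter_mset_cong refl) (auto simp: count_in_eq_0_iff)
    with that(2) show ?thesis by (simp add: count_in_def)
  qed
  have "prob {\<omega> \<in> space M. count_in Y (containing i) \<omega> = 0 \<and> count_in Y ?D \<omega> = r}
      \<le> prob {\<omega> \<in> space M. count_in Y ?A \<omega> = 0 \<and> count_in Y ?B \<omega> = r}"
  proof (rule finite_measure_mono)
    show "{\<omega> \<in> space M. count_in Y ?A \<omega> = 0 \<and> count_in Y ?B \<omega> = r} \<in> events"
      using measurable_count_in[OF sub(1)] measurable_count_in[OF sub(2)] by measurable
  qed (use m1 in \<open>auto simp: count_in_eq_0_iff\<close>)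
  also have "\<dots> = exp (- measure \<nu> ?A) * (measure \<nu> ?B ^ r / fact r * exp (- measure \<nu> ?B))"
    using prob_count_in_conj[OF sub _ ne, of 0 r] prob_count_in[OF sub(1), of 0]
      prob_count_in[OF sub(2), of r] by auto
  also have "\<dots> = measure \<nu> ?B ^ r / fact r * exp (- measure \<nu> ?D)"
    by (simp add: mB flip: exp_add)
  also have "\<dots> \<le> ((1 - \<delta>) * measure \<nu> ?D) ^ r / fact r * exp (- measure \<nu> ?D)"
    using le by (intro mult_right_mono divide_right_mono power_mono) auto
  also have "\<dots> = (1 - \<delta>) ^ r * prob {\<omega> \<in> space M. count_in Y ?D \<omega> = r}"
    using prob_count_in[OF large_subset, of \<delta> r] by (simp add: power_mult_distrib)
  finally show ?thesis .
qed

text \<open>Markov's inequality restricted to the event \<open>N\<close> of exactly \<open>r\<close>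
  large points: the uncovered fraction integrates over \<open>N\<close> to at most
  \<open>(1 - c) / 2 * prob N\<close>, so it can exceed \<open>1 - c\<close> on at most half of
  \<open>N\<close>.\<close>

lemma prob_covered_ge:
  assumes "0 < measure \<nu> (large \<delta>)" "\<delta> \<le> 1" "c < 1" "(1 - \<delta>) ^ r \<le> (1 - c) / 2"
  shows "prob {\<omega> \<in> space M. count_in Y (large \<delta>) \<omega> = r} / 2
    \<le> prob {\<omega> \<in> space M. uncovered \<omega> \<le> 1 - c}"
proof -
  define N where "N = {\<omega> \<in> space M. count_in Y (large \<delta>) \<omega> = r}"
  define G where "G = {\<omega> \<in> space M. uncovered \<omega> \<le> 1 - c}"
  define U where "U i = {\<omega> \<in> space M. count_in Y (containing i) \<omega> = 0 \<and> count_in Y (large \<delta>) \<omega> = r}" for i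
  have N [measurable]: "N \<in> events"
    unfolding N_def using measurable_count_in[OF large_subset] by measurable
  have G [measurable]: "G \<in> events" unfolding G_def by measurable
  have U: "U i \<in> events" for i
    unfolding U_def using measurable_count_in[OF large_subset] measurable_count_in[OF containing_subset]
    by measurable
  have "(1 - c) * prob (N - G) = expectation (\<lambda>\<omega>. (1 - c) * indicator (N - G) \<omega>)"
    by simp
  also have "\<dots> \<le> expectation (\<lambda>\<omega>. (\<Sum>i\<in>S. indicator (U i) \<omega>) / card S)"
  proof (rule integral_mono)
    show "integrable M (\<lambda>\<omega>. (\<Sum>i\<in>S. indicator (U i) \<omega>) / card S :: real)"
      using U by (intro integrable_divide_zero Bochner_Integration.integrable_sum
          integrable_real_indicator) (auto simp: less_top[symmetric])
    fix \<omega> assume w: "\<omega> \<in> space M"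
    show "(1 - c) * indicator (N - G) \<omega> \<le> (\<Sum>i\<in>S. indicator (U i) \<omega>) / card S"
    proof (cases "\<omega> \<in> N - G")
      case True
      \<comment> \<open>On \<open>N\<close> the count condition in \<open>U i\<close> holds
        automatically, leaving only that \<open>i\<close> is uncovered.\<close>
      have "uncovered \<omega> = (\<Sum>i\<in>S. indicator (U i) \<omega>) / card S"
        unfolding uncovered_def using True w
        by (intro arg_cong2[where f = divide] sum.cong refl, subst one_minus_covered[OF w])
           (auto simp: U_def N_def indicator_def)
      moreover have "1 - c \<le> uncovered \<omega>" using True w by (auto simp: G_def)
      ultimately show ?thesis using True by simp
    qed (auto intro!: divide_nonneg_nonneg sum_nonneg)
  qed (auto intro!: integrable_mult_right integrable_real_indicator simp: less_top[symmetric])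
  also have "\<dots> = (\<Sum>i\<in>S. prob (U i)) / card S"
    using U by (subst integral_divide_zero, subst Bochner_Integration.integral_sum)
      (auto simp: less_top[symmetric] intro!: integrable_real_indicator)
  also have "\<dots> \<le> (\<Sum>i\<in>S. (1 - \<delta>) ^ r * prob N) / card S"
    unfolding U_def N_def
    by (intro divide_right_mono sum_mono prob_uncovered_large_count_le assms) auto
  also have "\<dots> = (1 - \<delta>) ^ r * prob N" using card_S_pos by simp
  also have "\<dots> \<le> (1 - c) / 2 * prob N"
    using assms(4) by (rule mult_right_mono) simp
  finally have "(1 - c) * prob (N - G) \<le> (1 - c) * (prob N / 2)" by simp
  then have "prob (N - G) \<le> prob N / 2" using assms(3) by simp
  moreover have "prob N = prob (N - G) + prob (N \<inter> G)"
    using finite_measure_Diff'[of N G] by simp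
  moreover have "prob (N \<inter> G) \<le> prob G" by (intro finite_measure_mono) auto
  ultimately show ?thesis unfolding N_def[symmetric] G_def[symmetric] by linarith
qed

text \<open>Collects all that the limit argument uses, in terms of two numbers: \<open>a\<close>,
  the common mass of the sets containing a given site, and \<open>\<mu>\<close>, the mass of the
  large sets. The fourth bound is Markov's inequality for \<open>uncovered\<close>, whose mean is
  \<open>exp (- a)\<close>; it keeps \<open>a\<close> bounded.\<close>

lemma covering_bounds:
  assumes "0 < \<delta>" "\<delta> \<le> 1" "c < 1" "(1 - \<delta>) ^ r \<le> (1 - c) / 2" "0 < r"
  obtains a \<mu> where "0 \<le> \<mu>" "variance uncovered \<le> \<delta> * a + \<mu>" "\<delta> * \<mu> \<le> a"
    "(1 - c) * (1 - prob {\<omega> \<in> space M. uncovered \<omega> \<le> 1 - c}) \<le> exp (- a)"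
    "\<mu> ^ r / fact r * exp (- \<mu>) / 2 \<le> prob {\<omega> \<in> space M. uncovered \<omega> \<le> 1 - c}"
proof -
  obtain i where i: "i \<in> S" using S_ne by blast
  define a where "a = measure \<nu> (containing i)"
  define \<mu> where "\<mu> = measure \<nu> (large \<delta>)"
  define G where "G = {\<omega> \<in> space M. uncovered \<omega> \<le> 1 - c}"
  have G [measurable]: "G \<in> events" unfolding G_def by measurable
  \<comment> \<open>At threshold 0 every set is large, so the symmetry of large sets specializes to
    all sets.\<close>
  have "large 0 \<inter> containing j = containing j" for j
    using containing_subset[of j] by (auto simp: large_def)
  then have a: "measure \<nu> (containing j) = a" if "j \<in> S" for j
    using measure_large_containing_eq[OF that i, of 0] by (simp add: a_def)
  have "variance uncovered \<le> \<delta> * a + \<mu>"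
    using variance_uncovered_le[of \<delta>] assms(1) card_S_pos by (simp add: a \<mu>_def)
  moreover have "\<delta> * \<mu> \<le> a"
  proof -
    have "measure \<nu> (large \<delta> \<inter> containing i) \<le> a"
      unfolding a_def
      by (intro intensity.finite_measure_mono) (auto simp: sets_\<nu>_iff containing_subset)
    then show ?thesis using measure_large_containing_ge[OF i, of \<delta>] by (simp add: \<mu>_def)
  qed
  moreover have "(1 - c) * (1 - prob G) \<le> exp (- a)"
  proof -
    have "(1 - c) * (1 - prob G) = expectation (\<lambda>\<omega>. (1 - c) * indicator (space M - G) \<omega>)"
      by (simp add: prob_compl)
    also have "\<dots> \<le> expectation uncovered"
    proof (rule integral_mono)
      show "integrable M uncovered" by (rule integrable_uncovered)
      show "(1 - c) * indicator (space M - G) \<omega> \<le> uncovered \<omega>" if "\<omega> \<in> space M" for \<omega>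
        using that uncovered_bounds by (auto simp: G_def indicator_def)
    qed (auto intro!: integrable_mult_right integrable_real_indicator simp: less_top[symmetric])
    also have "\<dots> = exp (- a)"
      using card_S_pos by (simp add: expectation_uncovered a)
    finally show ?thesis .
  qed
  moreover have "\<mu> ^ r / fact r * exp (- \<mu>) / 2 \<le> prob G"
  proof (cases "\<mu> = 0")
    \<comment> \<open>Here \<open>0 < r\<close> matters: it makes \<open>\<mu> ^ r\<close>
      vanish.\<close>
    case True
    then show ?thesis using assms(5) by (simp add: zero_power)
  next
    case False
    then have "0 < measure \<nu> (large \<delta>)" by (simp add: \<mu>_def zero_less_measure_iff)
    from prob_covered_ge[OF this assms(2-4)] show ?thesis
      using prob_count_in[OF large_subset, of \<delta> r] by (simp add: \<mu>_def G_def)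
  qed
  ultimately show thesis
    by (intro that[of \<mu> a]) (auto simp: G_def \<mu>_def)
qed

end

section \<open>Representable vectors\<close>

lemma poisson_representable_bounds:
  fixes X :: "nat \<Rightarrow> 'w \<Rightarrow> real"
  assumes "n \<ge> 1" "permutation_invariant M {1..n} X" "poisson_representable M {1..n} X"
    and "0 < \<delta>" "\<delta> \<le> 1" "c < 1" "(1 - \<delta>) ^ r \<le> (1 - c) / 2" "0 < r"
  obtains a \<mu> where "0 \<le> \<mu>" "prob_space.variance M (sample_mean n X) \<le> \<delta> * a + \<mu>" "\<delta> * \<mu> \<le> a"
    "(1 - c) * (1 - measure M {\<omega> \<in> space M. sample_mean n X \<omega> \<ge> c}) \<le> exp (- a)"
    "\<mu> ^ r / fact r * exp (- \<mu>) / 2 \<le> measure M {\<omega> \<in> space M. sample_mean n X \<omega> \<ge> c}"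
proof -
  let ?S = "{1..n}"
  have bX: "binary_process M ?S X" using assms(3) by (simp add: poisson_representable_def)
  from assms(3) obtain \<nu> :: "nat set measure" and M' :: "nat set multiset measure" and Y
    where \<nu>: "space \<nu> = Pow ?S - {{}}" "sets \<nu> = Pow (Pow ?S - {{}})" "poisson_process M' \<nu> Y"
      and law: "process_law M ?S X = process_law M' ?S (covered Y)"
    unfolding poisson_representable_def by blast
  interpret poisson_cover ?S \<nu> M' Y
    using \<nu> assms(1) by unfold_locales auto
  have bY: "binary_process M' ?S (covered Y)" by (rule binary_process_covered)
  interpret exchangeable_poisson_cover ?S \<nu> M' Y
  proof
    fix \<pi> A assume p: "\<pi> permutes ?S" and A: "A \<subseteq> ?S"
    have pA: "\<pi> ` A \<subseteq> ?S" using permutes_image[OF p] A by blast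
    have bXp: "binary_process M ?S (\<lambda>i. X (\<pi> i))"
      using bX permutes_in_image[OF p] by (auto simp: binary_process_def)
    have "measure M' {\<omega> \<in> space M'. \<forall>i\<in>\<pi> ` A. covered Y i \<omega> = 0} =
        measure M {\<omega> \<in> space M. \<forall>i\<in>\<pi> ` A. X i \<omega> = 0}"
      by (rule process_law_prob_zero_eq[symmetric, OF bX bY law _ pA]) simp
    \<comment> \<open>The void event of the image set is the void event of \<open>A\<close> for the
      permuted vector, whose law is unchanged.\<close>
    also have "\<dots> = measure M {\<omega> \<in> space M. \<forall>i\<in>A. X (\<pi> i) \<omega> = 0}" by simp
    also have "\<dots> = measure M' {\<omega> \<in> space M'. \<forall>i\<in>A. covered Y i \<omega> = 0}"
      using assms(2) p law
      by (intro process_law_prob_zero_eq[OF bXp bY _ _ A]) (auto simp: permutation_invariant_def)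
    finally show "measure M' {\<omega> \<in> space M'. \<forall>i\<in>\<pi> ` A. covered Y i \<omega> = 0} =
        measure M' {\<omega> \<in> space M'. \<forall>i\<in>A. covered Y i \<omega> = 0}" .
  qed
  define m :: "(nat \<Rightarrow> real) \<Rightarrow> real" where "m x = (\<Sum>i\<in>?S. x i) / n" for x
  have m [measurable]: "m \<in> borel_measurable (\<Pi>\<^sub>M i\<in>?S. count_space {0, 1})"
    unfolding m_def by (rule measurable_coordinate_mean)
  have mX: "m (\<lambda>i\<in>?S. X i \<omega>) = sample_mean n X \<omega>" for \<omega>
    by (simp add: m_def sample_mean_def)
  have mY: "m (\<lambda>i\<in>?S. covered Y i \<omega>) = 1 - uncovered \<omega>" for \<omega>
    using uncovered_eq[of \<omega>] by (simp add: m_def)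
  have P: "measure M {\<omega> \<in> space M. sample_mean n X \<omega> \<ge> c} =
      prob {\<omega> \<in> space M'. uncovered \<omega> \<le> 1 - c}"
  proof -
    have "{x \<in> space (\<Pi>\<^sub>M i\<in>?S. count_space {0, 1 :: real}). m x \<ge> c} \<in> sets (\<Pi>\<^sub>M i\<in>?S. count_space {0, 1})"
      by measurable
    from process_law_prob_eq[OF bX bY law this] show ?thesis
      unfolding mX mY by (simp add: algebra_simps)
  qed
  have E: "(LINT \<omega>|M. sample_mean n X \<omega>) = 1 - expectation uncovered"
    using process_law_integral_eq[OF bX bY law m] integrable_uncovered
    unfolding mX mY by (simp add: prob_space)
  \<comment> \<open>The mean corresponds to \<open>1 - uncovered\<close>, and reflection preserves
    the variance.\<close>
  have V: "prob_space.variance M (sample_mean n X) = variance uncovered"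
  proof -
    have "(\<lambda>x. (m x - (1 - expectation uncovered))\<^sup>2) \<in> borel_measurable (\<Pi>\<^sub>M i\<in>?S. count_space {0, 1})"
      by measurable
    from process_law_integral_eq[OF bX bY law this] show ?thesis
      unfolding mX mY E by (simp add: power2_commute)
  qed
  show thesis
    by (rule covering_bounds[OF assms(4-8)], rule that) (simp_all only: P V)
qed

section \<open>Choice of constants and passage to the limit\<close>

theorem theorem5p1:
  fixes M :: "nat \<Rightarrow> 'w measure"
    and X :: "nat \<Rightarrow> nat \<Rightarrow> 'w \<Rightarrow> real"
    and c :: real
  assumes "\<And>n. n \<ge> 1 \<Longrightarrow> binary_process (M n) {1..n} (X n)"
    and "\<And>n. n \<ge> 1 \<Longrightarrow> permutation_invariant (M n) {1..n} (X n)"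
    and "0 < c" and "c < 1"
    and "(\<lambda>n. measure (M n) {\<omega> \<in> space (M n). sample_mean n (X n) \<omega> \<ge> c}) \<longlonglongrightarrow> 0"
    and "\<And>n. n \<ge> 1 \<Longrightarrow> poisson_representable (M n) {1..n} (X n)"
  shows "(\<lambda>n. prob_space.variance (M n) (sample_mean n (X n))) \<longlonglongrightarrow> 0"
proof (rule LIMSEQ_I)
  fix \<epsilon> :: real assume \<epsilon>: "0 < \<epsilon>"
  define P where "P n = measure (M n) {\<omega> \<in> space (M n). sample_mean n (X n) \<omega> \<ge> c}" for n
  \<comment> \<open>Chosen so that \<open>exp (- K)\<close> equals \<open>(1 - c) / 2\<close>; once
    \<open>P n < 1 / 2\<close>, the Markov bound gives \<open>a \<le> K\<close>.\<close>
  define K where "K = ln (2 / (1 - c))"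
  have K: "0 < K" using assms(3,4) by (simp add: K_def)
  \<comment> \<open>The second entry makes the small sets contribute at most
    \<open>\<epsilon> / 2\<close> to the variance.\<close>
  define \<delta> where "\<delta> = min 1 (\<epsilon> / (2 * K))"
  have \<delta>: "0 < \<delta>" "\<delta> \<le> 1" "\<delta> * K \<le> \<epsilon> / 2"
    using \<epsilon> K by (auto simp: \<delta>_def min_def field_simps)
  have "(\<lambda>r. (1 - \<delta>) ^ r) \<longlonglongrightarrow> 0" using \<delta> by (intro LIMSEQ_power_zero) auto
  then have "eventually (\<lambda>r. (1 - \<delta>) ^ r < (1 - c) / 2) sequentially"
    using assms(4) by (intro order_tendstoD) auto
  then have "eventually (\<lambda>r. (1 - \<delta>) ^ r < (1 - c) / 2 \<and> 0 < r) sequentially"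
    using eventually_gt_at_top[of 0] by (rule eventually_conj)
  then obtain r where r: "(1 - \<delta>) ^ r \<le> (1 - c) / 2" "0 < r"
    using eventually_happens'[OF sequentially_bot] less_imp_le by blast
  \<comment> \<open>A lower bound for \<open>\<mu> ^ r / fact r * exp (- \<mu>) / 2\<close> when
    \<mu> lies between \<open>\<epsilon> / 2\<close> and \<open>K / \<delta>\<close>. It does not
    depend on \<open>n\<close>, since \<open>r\<close> was fixed from \<delta> and \<open>c\<close>
    alone.\<close>
  define \<eta> where "\<eta> = (\<epsilon> / 2) ^ r / fact r * exp (- (K / \<delta>)) / 2"
  have "0 < \<eta>" using \<epsilon> by (simp add: \<eta>_def)
  then have "eventually (\<lambda>n. P n < min (1 / 2) \<eta>) sequentially"
    using assms(5) unfolding P_def by (intro order_tendstoD) auto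
  then obtain n0 where n0: "\<And>n. n \<ge> n0 \<Longrightarrow> P n < 1 / 2 \<and> P n < \<eta>"
    by (auto simp: eventually_sequentially)
  have "norm (prob_space.variance (M n) (sample_mean n (X n)) - 0) < \<epsilon>" if n: "n \<ge> max 1 n0" for n
  proof -
    have n1: "n \<ge> 1" using n by simp
    obtain a \<mu> where \<mu>: "0 \<le> \<mu>" "prob_space.variance (M n) (sample_mean n (X n)) \<le> \<delta> * a + \<mu>"
        "\<delta> * \<mu> \<le> a" "(1 - c) * (1 - P n) \<le> exp (- a)" "\<mu> ^ r / fact r * exp (- \<mu>) / 2 \<le> P n"
      unfolding P_def
      by (rule poisson_representable_bounds[OF n1 assms(2)[OF n1] assms(6)[OF n1] \<delta>(1,2) assms(4) r])
    have "exp (- K) = (1 - c) * (1 / 2)"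
      using assms(4) by (simp add: K_def exp_minus)
    also have "\<dots> \<le> (1 - c) * (1 - P n)"
      using n0[of n] n assms(4) by (intro mult_left_mono) auto
    also have "\<dots> \<le> exp (- a)" by (rule \<mu>(4))
    finally have aK: "a \<le> K" by simp
    then have \<mu>K: "\<mu> \<le> K / \<delta>" using \<mu>(3) \<delta>(1) by (simp add: field_simps)
    \<comment> \<open>Otherwise having exactly \<open>r\<close> large points would be likely enough
      to push \<open>P n\<close> up to \<eta>.\<close>
    have "\<mu> < \<epsilon> / 2"
    proof (rule ccontr)
      assume "\<not> \<mu> < \<epsilon> / 2"
      then have "\<eta> \<le> \<mu> ^ r / fact r * exp (- \<mu>) / 2"
        unfolding \<eta>_def using \<epsilon> \<mu>(1) \<mu>K
        by (intro divide_right_mono mult_mono power_mono) auto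
      then show False using \<mu>(5) n0[of n] n by simp
    qed
    moreover have "\<delta> * a \<le> \<epsilon> / 2"
      using mult_left_mono[OF aK, of \<delta>] \<delta>(1,3) by linarith
    moreover have "0 \<le> prob_space.variance (M n) (sample_mean n (X n))"
      by (rule integral_nonneg_AE) simp
    ultimately show ?thesis using \<mu>(2) by simp
  qed
  then show "\<exists>n0. \<forall>n\<ge>n0. norm (prob_space.variance (M n) (sample_mean n (X n)) - 0) < \<epsilon>"
    by blast
qed

end
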